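(* Let $w_0,w_1,\dots$ be i.i.d. random vectors in $\mathbb R^n$ with $\|w_i\|_\infty\le a_w$ (where $a_w>0$), mean zero and covariance $\Sigma_w=\mathbb E w_iw_i^T$. Let $g_1,\dots,g_{n_x}\in\mathbb R^n$, and let $\hat\Sigma_w^t=\frac1t\sum_{i=0}^{t-1}w_iw_i^T$ for $t\ge1$. Fix a failure probability $\delta\in(0,1)$. Then, with probability at least $1-\delta$, $$g_j^T\Sigma_wg_j\le g_j^T\hat\Sigma_w^tg_j+r_{tj}(\delta)$$ uniformly over (i.e. simultaneously for) all $t\ge1$ and $j=1,\dots,n_x$, where $$r_{tj}(\delta)=\|g_j\|_1^2\,a_w^2\sqrt{\frac{1}{2t}\log\left(\frac{\pi^4t^2n_x^2}{36\,\delta}\right)} .$$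
   Context: $\|\cdot\|_1$ and $\|\cdot\|_\infty$ are the usual $\ell_1$ and $\ell_\infty$ norms on $\mathbb R^n$; $\log$ is the natural logarithm. *)

theory Defs
  imports "HOL-Probability.Probability"
begin

definition l1_norm :: "real ^ 'n \<Rightarrow> real" where
  "l1_norm x = (\<Sum>i\<in>UNIV. \<bar>x $ i\<bar>)"

(* outer x y is the rank-one matrix x y^T. *)
definition outer :: "real ^ 'n \<Rightarrow> real ^ 'n \<Rightarrow> real ^ 'n ^ 'n" where
  "outer x y = (\<chi> i j. x $ i * y $ j)"

definition quad_form :: "real ^ 'n ^ 'n \<Rightarrow> real ^ 'n \<Rightarrow> real" where
  "quad_form A x = x \<bullet> (A *v x)"

definition empirical_cov :: "(nat \<Rightarrow> 'a \<Rightarrow> real ^ 'n) \<Rightarrow> nat \<Rightarrow> 'a \<Rightarrow> real ^ 'n ^ 'n" where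
  "empirical_cov w t \<omega> = (1 / real t) *\<^sub>R (\<Sum>i<t. outer (w i \<omega>) (w i \<omega>))"

definition conf_radius :: "real \<Rightarrow> nat \<Rightarrow> real ^ 'n \<Rightarrow> nat \<Rightarrow> real \<Rightarrow> real" where
  "conf_radius a_w n_x x t \<delta> =
     (l1_norm x)\<^sup>2 * a_w\<^sup>2 *
     sqrt (1 / (2 * real t) * ln (pi ^ 4 * (real t)\<^sup>2 * (real n_x)\<^sup>2 / (36 * \<delta>)))"

end

theory Submission
  imports Defs
begin

text \<open>
  For fixed \<open>t\<close> and \<open>j\<close> the quantities \<open>(w\<^sub>i \<bullet> g\<^sub>j)\<^sup>2\<close> are i.i.d. with values in
  \<open>[0, \<parallel>g\<^sub>j\<parallel>\<^sub>1\<^sup>2 a_w\<^sup>2]\<close> by Hoelder's inequality. Hoeffding's inequality bounds the probability that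
  the estimate fails by \<open>36 \<delta> / (\<pi>\<^sup>4 t\<^sup>2 n_x\<^sup>2)\<close>, and summing these bounds over \<open>j\<close> and \<open>t\<close> with
  \<open>\<Sum>1/t\<^sup>2 = \<pi>\<^sup>2/6\<close> gives \<open>6 \<delta> / (\<pi>\<^sup>2 n_x) \<le> \<delta>\<close>.
\<close>

lemma quad_form_eq_sum:
  "quad_form A x = (\<Sum>i\<in>UNIV. \<Sum>j\<in>UNIV. x $ i * A $ i $ j * x $ j)"
  by (simp add: quad_form_def inner_vec_def matrix_vector_mult_def sum_distrib_left mult.assoc)

lemma quad_form_outer: "quad_form (outer x x) y = (x \<bullet> y)\<^sup>2"
proof -
  have "(x \<bullet> y)\<^sup>2 = (\<Sum>i\<in>UNIV. \<Sum>j\<in>UNIV. (x $ i * y $ i) * (x $ j * y $ j))"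
    by (simp add: inner_vec_def power2_eq_square sum_product)
  then show ?thesis
    by (simp add: quad_form_eq_sum outer_def mult_ac)
qed

text \<open>For fixed \<open>x\<close> the form is linear in the matrix, and linear maps in finite
  dimension are bounded. This lets \<open>quad_form\<close> pass through both the empirical average
  and the Bochner expectation.\<close>

lemma bounded_linear_quad_form: "bounded_linear (\<lambda>A. quad_form A x)"
proof -
  have "linear (\<lambda>A. quad_form A x)"
    by (rule linearI)
      (simp_all add: quad_form_eq_sum algebra_simps sum.distrib sum_distrib_left)
  then show ?thesis
    by (simp add: linear_conv_bounded_linear)
qed

lemma quad_form_empirical_cov:
  "quad_form (empirical_cov w t \<omega>) x = (\<Sum>i<t. (w i \<omega> \<bullet> x)\<^sup>2) / real t"
proof -
  interpret bounded_linear "\<lambda>A. quad_form A x"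
    by (rule bounded_linear_quad_form)
  show ?thesis
    by (simp add: empirical_cov_def scaleR sum quad_form_outer)
qed

lemma l1_norm_nonneg: "0 \<le> l1_norm x"
  by (simp add: l1_norm_def sum_nonneg)

lemma l1_norm_eq_0_iff: "l1_norm x = 0 \<longleftrightarrow> x = 0"
  by (simp add: l1_norm_def sum_nonneg_eq_0_iff vec_eq_iff)

lemma abs_inner_le_infnorm_l1_norm: "\<bar>x \<bullet> y\<bar> \<le> infnorm x * l1_norm y"
proof -
  have "\<bar>x \<bullet> y\<bar> \<le> (\<Sum>i\<in>UNIV. \<bar>x $ i * y $ i\<bar>)"
    unfolding inner_vec_def inner_real_def by (rule sum_abs)
  also have "\<dots> \<le> (\<Sum>i\<in>UNIV. infnorm x * \<bar>y $ i\<bar>)"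
    by (intro sum_mono) (simp add: abs_mult mult_right_mono component_le_infnorm_cart)
  finally show ?thesis
    by (simp add: l1_norm_def sum_distrib_left)
qed

lemma inner_square_le:
  assumes "infnorm x \<le> a"
  shows "(x \<bullet> y)\<^sup>2 \<le> (l1_norm y)\<^sup>2 * a\<^sup>2"
proof -
  have "\<bar>x \<bullet> y\<bar> \<le> l1_norm y * a"
    using abs_inner_le_infnorm_l1_norm[of x y] mult_right_mono[OF assms l1_norm_nonneg[of y]]
    by (simp add: mult.commute)
  then have "\<bar>x \<bullet> y\<bar>\<^sup>2 \<le> (l1_norm y * a)\<^sup>2"
    by (intro power_mono) auto
  then show ?thesis
    by (simp add: power_mult_distrib)
qed

lemma continuous_on_outer_self: "continuous_on S (\<lambda>x. outer x x)"
  unfolding outer_def by (intro continuous_intros continuous_on_vec_lambda)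

text \<open>Almost surely \<open>X\<close> stays in a fixed Euclidean ball, whose image under the
  continuous map \<open>outer x x\<close> is compact, hence bounded. A measurable, almost surely
  bounded function is integrable under a probability measure.\<close>

lemma (in prob_space) integrable_outer_self:
  fixes X :: "'a \<Rightarrow> real ^ 'n"
  assumes [measurable]: "random_variable borel X"
    and bnd: "AE \<omega> in M. infnorm (X \<omega>) \<le> a"
  shows "integrable M (\<lambda>\<omega>. outer (X \<omega>) (X \<omega>))"
proof -
  \<comment> \<open>Converts the sup-norm bound into a Euclidean one, at the cost of the square root
    of the dimension.\<close>
  define R where "R = sqrt (real DIM(real ^ 'n)) * a"
  have "compact ((\<lambda>x. outer x x) ` cball (0 :: real ^ 'n) R)"
    by (intro compact_continuous_image continuous_on_outer_self compact_cball)
  then obtain B where B: "norm (outer x x) \<le> B" if "norm x \<le> R" for x :: "real ^ 'n"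
    by (force dest!: compact_imp_bounded simp: bounded_iff)
  have [measurable]: "(\<lambda>x :: real ^ 'n. outer x x) \<in> borel_measurable borel"
    by (rule borel_measurable_continuous_onI[OF continuous_on_outer_self])
  have "AE \<omega> in M. norm (outer (X \<omega>) (X \<omega>)) \<le> B"
    using bnd
  proof eventually_elim
    case (elim \<omega>)
    have "norm (X \<omega>) \<le> sqrt (real DIM(real ^ 'n)) * infnorm (X \<omega>)"
      by (rule norm_le_infnorm)
    also have "\<dots> \<le> R"
      unfolding R_def by (intro mult_left_mono elim) simp
    finally show ?case by (rule B)
  qed
  then show ?thesis
    by (intro integrable_const_bound) measurable
qed

text \<open>Reduces the matrix statement to the mean of a scalar variable, to which Hoeffding's
  inequality applies.\<close>

lemma (in prob_space) quad_form_integral_outer: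
  assumes "random_variable borel X"
    and "AE \<omega> in M. infnorm (X \<omega>) \<le> a"
  shows "quad_form (expectation (\<lambda>\<omega>. outer (X \<omega>) (X \<omega>))) y = expectation (\<lambda>\<omega>. (X \<omega> \<bullet> y)\<^sup>2)"
  using integral_bounded_linear[OF bounded_linear_quad_form integrable_outer_self[OF assms], of y]
  by (simp add: quad_form_outer)

text \<open>The first term of the Basel series is at most its sum. The bound serves twice: for the
  sign of the logarithm in the radius and for the final constant.\<close>

lemma pi_square_ge_6: "6 \<le> pi\<^sup>2"
proof -
  have "sum (\<lambda>n. 1 / (real n + 1)\<^sup>2) {..<1} \<le> pi\<^sup>2 / 6"
    using inverse_squares_sums by (intro sum_le_suminf[THEN order_trans])
      (auto simp: sums_iff add.commute)
  then show ?thesis by simp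
qed

lemma (in prob_space) prob_UN_inverse_squares_le:
  assumes A: "\<And>t. t \<ge> 1 \<Longrightarrow> A t \<in> events"
    and le: "\<And>t. t \<ge> 1 \<Longrightarrow> prob (A t) \<le> c / (real t)\<^sup>2"
  shows "prob (\<Union>t\<in>{1..}. A t) \<le> c * (pi\<^sup>2 / 6)"
proof -
  have sums: "(\<lambda>n. c / (real (Suc n))\<^sup>2) sums (c * (pi\<^sup>2 / 6))"
    using sums_mult[OF inverse_squares_sums, of c] by (simp add: add.commute)
  \<comment> \<open>Countable subadditivity for real-valued probabilities needs a convergent series;
    comparison with the Basel series supplies it.\<close>
  have summ: "summable (\<lambda>n. prob (A (Suc n)))"
    by (rule summable_comparison_test'[OF sums_summable[OF sums], of 0]) (use le in force)
  have "(\<Union>t\<in>{1..}. A t) = (\<Union>n. A (Suc n))"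
    by (auto simp: Suc_le_eq gr0_conv_Suc)
  also have "prob \<dots> \<le> (\<Sum>n. prob (A (Suc n)))"
    using A by (intro finite_measure_subadditive_countably summ) auto
  also have "\<dots> \<le> c * (pi\<^sup>2 / 6)"
    using suminf_le[OF _ summ sums_summable[OF sums]] le sums_unique[OF sums] by force
  finally show ?thesis .
qed

lemma (in prob_space) prob_quad_form_deviation_le:
  fixes w :: "nat \<Rightarrow> 'a \<Rightarrow> real ^ 'n"
  assumes indep: "indep_vars (\<lambda>_. borel) w UNIV"
    and ident: "\<And>i. distr M borel (w i) = distr M borel (w 0)"
    and a: "a > 0"
    and bnd: "AE \<omega> in M. infnorm (w 0 \<omega>) \<le> a"
    and "t \<ge> 1" "n \<ge> 1" and \<delta>: "0 < \<delta>" "\<delta> < 1"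
  shows "prob {\<omega> \<in> space M. quad_form (empirical_cov w t \<omega>) x + conf_radius a n x t \<delta>
            < expectation (\<lambda>\<omega>. (w 0 \<omega> \<bullet> x)\<^sup>2)}
         \<le> 36 * \<delta> / (pi ^ 4 * (real t)\<^sup>2 * (real n)\<^sup>2)"
    (is "prob ?E \<le> ?p")
\<comment> \<open>For \<open>x = 0\<close> the range of the variables shrinks to a point and the
  Hoeffding exponent would divide by zero. The failure event then reads 0 < 0 and is empty.\<close>
proof (cases "x = 0")
  case True
  then show ?thesis
    using \<delta> by (simp add: quad_form_empirical_cov conf_radius_def l1_norm_def)
next
  case False
  have w [measurable]: "random_variable borel (w i)" for i
    using indep by (auto simp: indep_vars_def)
  define b where "b = (l1_norm x)\<^sup>2 * a\<^sup>2"
  have b: "b > 0"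
    using False a by (simp add: b_def l1_norm_eq_0_iff)
  define L where "L = ln (pi ^ 4 * (real t)\<^sup>2 * (real n)\<^sup>2 / (36 * \<delta>))"
  define \<epsilon> where "\<epsilon> = conf_radius a n x t \<delta>"
  have \<epsilon>_eq: "\<epsilon> = b * sqrt (1 / (2 * real t) * L)"
    by (simp add: \<epsilon>_def conf_radius_def b_def L_def)
  text \<open>The argument of the square root is nonnegative because \<open>\<pi>\<^sup>4 \<ge> 36 > 36 \<delta>\<close>.\<close>
  have L: "L \<ge> 0"
  proof -
    have "36 * \<delta> \<le> 6\<^sup>2 * 1 * 1"
      using \<delta> by simp
    also have "\<dots> \<le> (pi\<^sup>2)\<^sup>2 * (real t)\<^sup>2 * (real n)\<^sup>2"
      using \<open>t \<ge> 1\<close> \<open>n \<ge> 1\<close> pi_square_ge_6 by (intro mult_mono power_mono one_le_power) auto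
    finally have "1 \<le> pi ^ 4 * (real t)\<^sup>2 * (real n)\<^sup>2 / (36 * \<delta>)"
      using \<delta> by (simp flip: power_mult)
    then show ?thesis
      unfolding L_def by (rule ln_ge_zero)
  qed
  have \<epsilon>: "\<epsilon> \<ge> 0"
    using b L by (simp add: \<epsilon>_eq)
  interpret Hoeffding_ineq_iid M "{..<t}" "\<lambda>i \<omega>. (w i \<omega> \<bullet> x)\<^sup>2" "\<lambda>\<omega>. (w 0 \<omega> \<bullet> x)\<^sup>2" 0 b
    "expectation (\<lambda>\<omega>. (w 0 \<omega> \<bullet> x)\<^sup>2)"
  proof unfold_locales
    show "indep_vars (\<lambda>_. borel) (\<lambda>i \<omega>. (w i \<omega> \<bullet> x)\<^sup>2) {..<t}"
      by (rule indep_vars_compose2[OF indep_vars_subset[OF indep]]) auto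
    show "distr M borel (\<lambda>\<omega>. (w i \<omega> \<bullet> x)\<^sup>2) = distr M borel (\<lambda>\<omega>. (w 0 \<omega> \<bullet> x)\<^sup>2)" for i
    proof -
      \<comment> \<open>The law of the square is the image of the law of \<open>w k\<close> under a
        map that does not depend on \<open>k\<close>.\<close>
      have "distr M borel (\<lambda>\<omega>. (w k \<omega> \<bullet> x)\<^sup>2) = distr (distr M borel (w k)) borel (\<lambda>y. (y \<bullet> x)\<^sup>2)"
        for k
        by (subst distr_distr) (auto simp: o_def)
      then show ?thesis
        by (simp add: ident[of i])
    qed
    show "AE \<omega> in M. (w 0 \<omega> \<bullet> x)\<^sup>2 \<in> {0..b}"
      using bnd by eventually_elim (simp add: b_def inner_square_le)
  qed auto
  \<comment> \<open>Weakening the strict inequality puts the event into the lower-tail form of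
    Hoeffding's inequality.\<close>
  have "prob ?E \<le> prob {\<omega> \<in> space M. (\<Sum>i<t. (w i \<omega> \<bullet> x)\<^sup>2) / real (card {..<t})
            \<le> expectation (\<lambda>\<omega>. (w 0 \<omega> \<bullet> x)\<^sup>2) - \<epsilon>}"
    by (intro finite_measure_mono) (auto simp: quad_form_empirical_cov \<epsilon>_def)
  also have "\<dots> \<le> exp (- 2 * real (card {..<t}) * \<epsilon>\<^sup>2 / (b - 0)\<^sup>2)"
    by (rule Hoeffding_ineq_le') (use \<epsilon> b \<open>t \<ge> 1\<close> in \<open>auto simp: lessThan_empty_iff\<close>)
  \<comment> \<open>The radius is chosen for this identity: \<open>\<epsilon>\<close> squared is b^2
    L / (2t), so t and b cancel.\<close>
  also have "- 2 * real (card {..<t}) * \<epsilon>\<^sup>2 / (b - 0)\<^sup>2 = - L"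
    using b L \<open>t \<ge> 1\<close> by (simp add: \<epsilon>_eq power_mult_distrib)
  also have "exp (- L) = ?p"
    using \<delta> \<open>t \<ge> 1\<close> \<open>n \<ge> 1\<close> by (simp add: L_def exp_minus)
  finally show ?thesis .
qed

theorem lemma2:
  fixes M :: "'a measure"
    and w :: "nat \<Rightarrow> 'a \<Rightarrow> real ^ 'n"
    and g :: "nat \<Rightarrow> real ^ 'n"
    and \<Sigma>\<^sub>w :: "real ^ 'n ^ 'n"
    and a_w \<delta> :: real
    and n_x :: nat
  assumes prob: "prob_space M"
    and indep: "prob_space.indep_vars M (\<lambda>_. borel) w UNIV"
    and ident: "\<And>i. distr M borel (w i) = distr M borel (w 0)"
    and a_w_pos: "a_w > 0"
    and bounded: "\<And>i. AE \<omega> in M. infnorm (w i \<omega>) \<le> a_w"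
    and mean_zero: "\<And>i. integral\<^sup>L M (w i) = 0"
    and cov: "\<And>i. \<Sigma>\<^sub>w = integral\<^sup>L M (\<lambda>\<omega>. outer (w i \<omega>) (w i \<omega>))"
    and delta: "0 < \<delta>" "\<delta> < 1"
  shows "measure M {\<omega> \<in> space M. \<forall>t\<ge>1. \<forall>j\<in>{1..n_x}.
           quad_form \<Sigma>\<^sub>w (g j)
             \<le> quad_form (empirical_cov w t \<omega>) (g j) + conf_radius a_w n_x (g j) t \<delta>}
         \<ge> 1 - \<delta>"
proof -
  interpret prob_space M
    by (rule prob)
  have w [measurable]: "random_variable borel (w i)" for i
    using indep by (auto simp: indep_vars_def)
  have cov_eq: "quad_form \<Sigma>\<^sub>w x = expectation (\<lambda>\<omega>. (w 0 \<omega> \<bullet> x)\<^sup>2)" for x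
    unfolding cov[of 0] by (rule quad_form_integral_outer[OF w bounded])
  have [measurable]: "(\<lambda>\<omega>. quad_form (empirical_cov w t \<omega>) x) \<in> borel_measurable M" for t x
    unfolding quad_form_empirical_cov by measurable
  define E where "E t j = {\<omega> \<in> space M.
      quad_form (empirical_cov w t \<omega>) (g j) + conf_radius a_w n_x (g j) t \<delta> < quad_form \<Sigma>\<^sub>w (g j)}"
    for t j
  have E [measurable]: "E t j \<in> events" for t j
    unfolding E_def by measurable
  have "prob (\<Union>j\<in>{1..n_x}. E t j) \<le> 36 * \<delta> / pi ^ 4 / (real t)\<^sup>2" if t: "t \<ge> 1" for t
  \<comment> \<open>With no directions the union is empty; otherwise the bound may divide by
    \<open>n_x\<close>.\<close>
  proof (cases "n_x = 0")
    case True
    then show ?thesis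
      using \<open>0 < \<delta>\<close> by simp
  next
    case False
    have "prob (\<Union>j\<in>{1..n_x}. E t j) \<le> (\<Sum>j\<in>{1..n_x}. prob (E t j))"
      by (intro finite_measure_subadditive_finite) auto
    also have "\<dots> \<le> (\<Sum>j\<in>{1..n_x}. 36 * \<delta> / (pi ^ 4 * (real t)\<^sup>2 * (real n_x)\<^sup>2))"
      unfolding E_def cov_eq using False t delta
      by (intro sum_mono prob_quad_form_deviation_le indep ident a_w_pos bounded) auto
    \<comment> \<open>There are \<open>n_x\<close> equal terms, each with the square of
      \<open>n_x\<close> in its denominator, so one factor 1/\<open>n_x\<close> survives. It is then
      bounded by 1, leaving the form c / t^2.\<close>
    also have "\<dots> = 36 * \<delta> / pi ^ 4 / (real t)\<^sup>2 / real n_x"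
      using False by (simp add: power2_eq_square)
    also have "\<dots> \<le> 36 * \<delta> / pi ^ 4 / (real t)\<^sup>2 / 1"
      using False \<open>0 < \<delta>\<close> by (intro divide_left_mono) auto
    finally show ?thesis by simp
  qed
  then have "prob (\<Union>t\<in>{1..}. \<Union>j\<in>{1..n_x}. E t j) \<le> 36 * \<delta> / pi ^ 4 * (pi\<^sup>2 / 6)"
    by (intro prob_UN_inverse_squares_le) auto
  also have "\<dots> = \<delta> * (6 / pi\<^sup>2)"
    by (simp add: power4_eq_xxxx power2_eq_square)
  also have "\<dots> \<le> \<delta>"
    using pi_square_ge_6 \<open>0 < \<delta>\<close> by (intro mult_left_le) auto
  finally have "1 - \<delta> \<le> 1 - prob (\<Union>t\<in>{1..}. \<Union>j\<in>{1..n_x}. E t j)"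
    by simp
  also have "\<dots> = prob (space M - (\<Union>t\<in>{1..}. \<Union>j\<in>{1..n_x}. E t j))"
    by (intro prob_compl[symmetric]) auto
  \<comment> \<open>The strict inequality in \<open>E\<close> makes the complement exactly the
    required non-strict estimate.\<close>
  also have "space M - (\<Union>t\<in>{1..}. \<Union>j\<in>{1..n_x}. E t j) =
      {\<omega> \<in> space M. \<forall>t\<ge>1. \<forall>j\<in>{1..n_x}. quad_form \<Sigma>\<^sub>w (g j)
          \<le> quad_form (empirical_cov w t \<omega>) (g j) + conf_radius a_w n_x (g j) t \<delta>}"
    by (force simp: E_def not_less[symmetric])
  finally show ?thesis .
qed

end
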